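(* Let $\mathcal{F}_0$ be the class of all continuous Lebesgue probability densities on $\mathbb{R}$ with a unique local maximum. The mode is not elicitable relative to $\mathcal{F}_0$; that is, there exists no strictly $\mathcal{F}_0$-consistent scoring function $s\colon\mathbb{R}\times\mathbb{R}\to\mathbb{R}$ for the mode.
   Context: $\mathcal{F}_0$ denotes the class of all continuous functions $f\colon\mathbb{R}\to[0,\infty)$ with $\int_{\mathbb{R}} f(y)\,\mathrm{d}y=1$ that have a unique local maximum (i.e. there is exactly one point of $\mathbb{R}$ at which $f$ attains a local maximum). The mode of a probability density consists of its global maxima; for $f\in\mathcal{F}_0$ it is a singleton and is identified with its unique element, $\mathrm{mode}(f)\in\mathbb{R}$. A scoring function is a measurable function $s\colon\mathbb{R}\times\mathbb{R}\to\mathbb{R}$. It is called strictly $\mathcal{F}_0$-consistent for the mode if (i) $\int |s(x,y)f(y)|\,\mathrm{d}y<\infty$ for all $x\in\mathbb{R}$ and all $f\in\mathcal{F}_0$, and (ii) for all $f\in\mathcal{F}_0$ and all $x\in\mathbb{R}$, with $t=\mathrm{mode}(f)$, $$\int s(t,y)f(y)\,\mathrm{d}y\le\int s(x,y)f(y)\,\mathrm{d}y,$$ and equality implies $x=t$. The mode is called elicitable relative to $\mathcal{F}_0$ if it admits a strictly $\mathcal{F}_0$-consistent scoring function. *)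

theory Defs
  imports "HOL-Analysis.Analysis"
begin

definition is_local_max :: "(real \<Rightarrow> real) \<Rightarrow> real \<Rightarrow> bool" where
  "is_local_max f t \<longleftrightarrow> (\<forall>\<^sub>F x in nhds t. f x \<le> f t)"

text \<open>
  Local maxima are not required to be strict, so members of this class have no plateaus;
  in particular they vanish nowhere.
\<close>

definition F0 :: "(real \<Rightarrow> real) set" where
  "F0 = {f. continuous_on UNIV f \<and> (\<forall>y. 0 \<le> f y)
          \<and> integrable lborel f \<and> (LINT y|lborel. f y) = 1
          \<and> (\<exists>!t. is_local_max f t)}"

definition mode_set :: "(real \<Rightarrow> real) \<Rightarrow> real set" where
  "mode_set f = {t. \<forall>y. f y \<le> f t}"

text \<open>
  Only meaningful if there is exactly one global maximum; on \<open>F0\<close> this is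
  \<open>mode_set_F0\<close> below.
\<close>

definition mode :: "(real \<Rightarrow> real) \<Rightarrow> real" where
  "mode f = the_elem (mode_set f)"

definition scoring_function :: "(real \<Rightarrow> real \<Rightarrow> real) \<Rightarrow> bool" where
  "scoring_function s \<longleftrightarrow> case_prod s \<in> borel_measurable (borel \<Otimes>\<^sub>M borel)"

definition strictly_consistent ::
    "(real \<Rightarrow> real) set \<Rightarrow> ((real \<Rightarrow> real) \<Rightarrow> real) \<Rightarrow> (real \<Rightarrow> real \<Rightarrow> real) \<Rightarrow> bool" where
  "strictly_consistent F T s \<longleftrightarrow>
     (\<forall>f\<in>F. \<forall>x. integrable lborel (\<lambda>y. s x y * f y)) \<and>
     (\<forall>f\<in>F. \<forall>x.
        (LINT y|lborel. s (T f) y * f y) \<le> (LINT y|lborel. s x y * f y) \<and>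
        ((LINT y|lborel. s (T f) y * f y) = (LINT y|lborel. s x y * f y) \<longrightarrow> x = T f))"

definition elicitable :: "(real \<Rightarrow> real) set \<Rightarrow> ((real \<Rightarrow> real) \<Rightarrow> real) \<Rightarrow> bool" where
  "elicitable F T \<longleftrightarrow> (\<exists>s. scoring_function s \<and> strictly_consistent F T s)"

lemma F0_small_value:
  assumes f: "f \<in> F0" and c: "c > 0"
  shows "\<exists>y\<in>{p..p + 2 / c}. f y < c"
proof (rule ccontr)
  assume "\<not> ?thesis"
  then have ge: "c \<le> f y" if "y \<in> {p..p + 2 / c}" for y
    using that by force
  have nonneg: "0 \<le> f y" and int: "integrable lborel f" and one: "(LINT y|lborel. f y) = 1" for y
    using f by (auto simp: F0_def)
  have "(LINT y|lborel. c * indicator {p..p + 2 / c} y) \<le> (LINT y|lborel. f y)"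
  proof (rule integral_mono[OF _ int])
    show "integrable lborel (\<lambda>y. c * indicator {p..p + 2 / c} y)"
      by (intro integrable_mult_right integrable_real_indicator) (auto simp: emeasure_lborel_Icc_eq)
  qed (auto simp: indicator_def ge nonneg)
  moreover have "(LINT y|lborel. c * indicator {p..p + 2 / c} y) = 2"
    using c by simp
  ultimately show False
    using one by simp
qed

lemma mode_set_F0:
  assumes f: "f \<in> F0"
  shows "\<exists>t. mode_set f = {t} \<and> is_local_max f t"
proof -
  have cont: "continuous_on S f" and nonneg: "0 \<le> f y" and ex1: "\<exists>!t. is_local_max f t" for S y
    using f continuous_on_subset by (auto simp: F0_def)
  obtain t where t: "is_local_max f t" and uniq: "\<And>u. is_local_max f u \<Longrightarrow> u = t"
    using ex1 by blast
  have max: "f a \<le> f t" for a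
  proof (rule ccontr)
    assume "\<not> f a \<le> f t"
    then have a: "f t < f a" by simp
    with nonneg[of t] have pos: "f a > 0" by linarith
    obtain b where b: "b \<ge> a" "f b < f a"
      using F0_small_value[OF f pos, of a] by auto
    obtain b' where b': "b' \<le> a" "f b' < f a"
      using F0_small_value[OF f pos, of "a - 2 / f a"] by auto
    have "compact {b'..b}" "{b'..b} \<noteq> {}" using b b' by auto
    from continuous_attains_sup[OF this cont]
    obtain m where m: "m \<in> {b'..b}" "\<And>y. y \<in> {b'..b} \<Longrightarrow> f y \<le> f m" by blast
    have am: "f a \<le> f m" using m(2)[of a] b b' by simp
    have "m \<noteq> b" "m \<noteq> b'" using am b b' by auto
    with m(1) have "m \<in> {b'<..<b}" by auto
    then have "\<forall>\<^sub>F x in nhds m. x \<in> {b'<..<b}"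
      by (intro eventually_nhds_in_open) auto
    then have "is_local_max f m"
      unfolding is_local_max_def by eventually_elim (use m(2) in auto)
    with uniq am a show False by fastforce
  qed
  have "u = t" if "u \<in> mode_set f" for u
    using that by (intro uniq) (auto simp: mode_set_def is_local_max_def)
  with max have "mode_set f = {t}" by (auto simp: mode_set_def)
  with t show ?thesis by blast
qed

end

theory Submission
  imports Defs
begin

text \<open>
  Suppose \<open>s\<close> is strictly consistent. The uniform density on \<open>{p..q}\<close> is a limit, in a dominated
  way, of strictly unimodal densities whose mode is any prescribed point \<open>m\<close> of \<open>{p..q}\<close>
  (\<open>plateau\<close> below). Consistency survives the limit, so all points of \<open>{p..q}\<close> have the same score
  under this uniform density (\<open>interval_score_eq_inside\<close>): a plateau cannot decide between the points
  on it.

  Scores over intervals are additive in the interval, and this carries the equality to reports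
  outside the interval: for \<open>x > q\<close> the points \<open>q\<close> and \<open>x\<close> have the same score over
  \<open>{p..x}\<close> and over \<open>{q..x}\<close>, hence also over the difference \<open>{p..q}\<close>, where \<open>q\<close> in turn scores
  the same as \<open>p\<close> (\<open>interval_score_eq\<close>). In particular \<open>0\<close> and \<open>1\<close> have the same score over every
  interval \<open>{-r..r}\<close>.

  Finally, the density proportional to \<open>exp (- \<bar>y\<bar>)\<close> is a mixture of uniform densities on intervals
  \<open>{-r..r}\<close> (\<open>laplace_integral_zero_if_symmetric_intervals\<close>). So \<open>0\<close> and \<open>1\<close> also
  have the same score under this density, although its mode is \<open>0\<close>; this contradicts strictness.
\<close>

section \<open>Strictly unimodal functions and the class of densities\<close>

definition strictly_unimodal :: "real \<Rightarrow> (real \<Rightarrow> real) \<Rightarrow> bool" where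
  "strictly_unimodal m f \<longleftrightarrow>
     (\<forall>x y. x < y \<and> y \<le> m \<longrightarrow> f x < f y) \<and> (\<forall>x y. m \<le> x \<and> x < y \<longrightarrow> f y < f x)"

lemma strictly_unimodal_less_peak:
  assumes "strictly_unimodal m f" "y \<noteq> m"
  shows "f y < f m"
  using assms unfolding strictly_unimodal_def by (metis linorder_neqE order_refl)

lemma strictly_unimodal_scale:
  assumes "strictly_unimodal m f" "c > 0"
  shows "strictly_unimodal m (\<lambda>y. f y / c)"
  using assms by (simp add: strictly_unimodal_def divide_strict_right_mono)

lemma is_local_max_strictly_unimodal_iff:
  assumes f: "strictly_unimodal m f"
  shows "is_local_max f t \<longleftrightarrow> t = m"
proof
  assume "is_local_max f t"
  then obtain e where e: "e > 0" "\<And>x. \<bar>x - t\<bar> < e \<Longrightarrow> f x \<le> f t"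
    by (auto simp: is_local_max_def eventually_nhds_metric dist_real_def)
  show "t = m"
  proof (rule ccontr)
    assume "t \<noteq> m"
    then consider "t < m" | "m < t" by linarith
    then show False
    proof cases
      case 1
      define x where "x = min m (t + e / 2)"
      have "t < x" "x \<le> m" "\<bar>x - t\<bar> < e" using 1 e(1) by (auto simp: x_def)
      with e(2)[of x] f show False by (force simp: strictly_unimodal_def)
    next
      case 2
      define x where "x = max m (t - e / 2)"
      have "x < t" "m \<le> x" "\<bar>x - t\<bar> < e" using 2 e(1) by (auto simp: x_def)
      with e(2)[of x] f show False by (force simp: strictly_unimodal_def)
    qed
  qed
next
  assume "t = m"
  then show "is_local_max f t"
    using strictly_unimodal_less_peak[OF f]
    by (auto simp: is_local_max_def intro!: always_eventually) (metis less_imp_le order_refl)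
qed

lemma mode_strictly_unimodal:
  assumes "strictly_unimodal m f"
  shows "mode f = m"
proof -
  have "mode_set f = {m}"
    using strictly_unimodal_less_peak[OF assms] unfolding mode_set_def
    by auto (metis not_le, metis less_imp_le order_refl)
  then show ?thesis by (simp add: mode_def)
qed

lemma integral_pos_if_pos:
  fixes f :: "real \<Rightarrow> real"
  assumes "integrable lborel f" "\<And>y. 0 < f y"
  shows "0 < (LINT y|lborel. f y)"
proof -
  have "(LINT y|lborel. f y) \<noteq> 0"
  proof
    assume "(LINT y|lborel. f y) = 0"
    then have "AE y in lborel. f y = 0"
      using integral_nonneg_eq_0_iff_AE[OF assms(1)] assms(2) by (auto simp: less_imp_le)
    then have "AE y in (lborel :: real measure). False"
      by eventually_elim (use assms(2) in \<open>metis less_irrefl\<close>)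
    then show False by (simp add: AE_iff_measurable[OF _ refl])
  qed
  moreover have "0 \<le> (LINT y|lborel. f y)"
    using assms(2) by (intro integral_nonneg_AE) (auto simp: less_imp_le)
  ultimately show ?thesis by linarith
qed

lemma normalized_in_F0:
  assumes "continuous_on UNIV f" "integrable lborel f" "\<And>y. 0 < f y" "strictly_unimodal m f"
  shows "(\<lambda>y. f y / (LINT y|lborel. f y)) \<in> F0"
proof -
  define c where "c = (LINT y|lborel. f y)"
  have c: "c > 0" using integral_pos_if_pos[OF assms(2,3)] by (simp add: c_def)
  have "\<exists>!t. is_local_max (\<lambda>y. f y / c) t"
    using is_local_max_strictly_unimodal_iff[OF strictly_unimodal_scale[OF assms(4) c]] by simp
  moreover have "continuous_on UNIV (\<lambda>y. f y / c)"
    using assms(1) c by (intro continuous_intros) auto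
  moreover have "(LINT y|lborel. f y / c) = 1"
    using c by (simp add: c_def)
  ultimately show ?thesis
    using assms(2,3) c unfolding F0_def c_def by (auto simp: less_imp_le)
qed

text \<open>
  Consistency is invariant under scaling of the density, so normalization can be dropped altogether.
\<close>

lemma consistent_unnormalized:
  assumes s: "strictly_consistent F0 mode s"
    and f: "continuous_on UNIV f" "integrable lborel f" "\<And>y. 0 < f y" "strictly_unimodal m f"
  shows "integrable lborel (\<lambda>y. s x y * f y)"
    and "(LINT y|lborel. s m y * f y) \<le> (LINT y|lborel. s x y * f y)"
    and "(LINT y|lborel. s m y * f y) = (LINT y|lborel. s x y * f y) \<Longrightarrow> x = m"
proof -
  define c where "c = (LINT y|lborel. f y)"
  have c: "c > 0" using integral_pos_if_pos[OF f(2,3)] by (simp add: c_def)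
  have F: "(\<lambda>y. f y / c) \<in> F0"
    using normalized_in_F0[OF f] by (simp add: c_def)
  have mode: "mode (\<lambda>y. f y / c) = m"
    by (intro mode_strictly_unimodal strictly_unimodal_scale f(4) c)
  have int: "integrable lborel (\<lambda>y. s x y * (f y / c))"
    and le: "(LINT y|lborel. s m y * (f y / c)) \<le> (LINT y|lborel. s x y * (f y / c))"
    and eq: "(LINT y|lborel. s m y * (f y / c)) = (LINT y|lborel. s x y * (f y / c)) \<Longrightarrow> x = m"
    using s[unfolded strictly_consistent_def, THEN conjunct1, rule_format, OF F, of x]
      s[unfolded strictly_consistent_def, THEN conjunct2, rule_format, OF F, of x]
    unfolding mode by blast+
  show "integrable lborel (\<lambda>y. s x y * f y)"
    using integrable_mult_right[OF int, of c] c by simp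
  show "(LINT y|lborel. s m y * f y) \<le> (LINT y|lborel. s x y * f y)"
    using le c by (simp add: divide_le_cancel)
  show "(LINT y|lborel. s m y * f y) = (LINT y|lborel. s x y * f y) \<Longrightarrow> x = m"
    using eq by simp
qed

section \<open>The Laplace kernel\<close>

lemma integrable_laplace: "integrable lborel (\<lambda>y::real. exp (- \<bar>y - m\<bar>))"
proof -
  have "(\<lambda>y::real. exp (- 1 * y)) integrable_on {0..}"
    using has_integral_exp_minus_to_infinity[of 1 0] by (auto simp: integrable_on_def)
  then have "set_integrable lebesgue {0..} (\<lambda>y::real. exp (- 1 * y))"
    by (intro nonnegative_absolutely_integrable_1) auto
  then have half: "integrable lborel (\<lambda>y::real. indicator {0..} y * exp (- y))"
    unfolding set_integrable_def by (subst (asm) integrable_completion) auto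
  have "integrable lborel (\<lambda>y::real. indicator {0..} y * exp (- y) + indicator {0..} (- y) * exp y)"
    using half lborel_integrable_real_affine[OF half, of "-1" 0] by auto
  then have "integrable lborel (\<lambda>y::real. exp (- \<bar>y\<bar>))"
    by (rule Bochner_Integration.integrable_bound) (auto simp: indicator_def)
  from lborel_integrable_real_affine[OF this, of 1 "-m"] show ?thesis by simp
qed

lemma strictly_unimodal_laplace: "strictly_unimodal m (\<lambda>y. exp (- \<bar>y - m\<bar>))"
  by (auto simp: strictly_unimodal_def)

lemma borel_measurable_if_integrable_laplace:
  fixes g :: "real \<Rightarrow> real"
  assumes "integrable lborel (\<lambda>y. g y * exp (- \<bar>y - m\<bar>))"
  shows "g \<in> borel_measurable borel"
proof -
  have "(\<lambda>y. g y * exp (- \<bar>y - m\<bar>)) \<in> borel_measurable borel"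
    using borel_measurable_integrable[OF assms] by simp
  then have "(\<lambda>y. g y * exp (- \<bar>y - m\<bar>) * exp \<bar>y - m\<bar>) \<in> borel_measurable borel"
    by measurable
  then show ?thesis by (simp add: mult.assoc flip: exp_add)
qed

lemma integrable_on_interval_if_integrable_laplace:
  fixes g :: "real \<Rightarrow> real"
  assumes g: "integrable lborel (\<lambda>y. g y * exp (- \<bar>y - m\<bar>))"
  shows "integrable lborel (\<lambda>y. g y * indicator {p..q} y)"
proof (rule Bochner_Integration.integrable_bound)
  define C where "C = exp (\<bar>p - m\<bar> + \<bar>q - m\<bar>)"
  show "integrable lborel (\<lambda>y. C * (g y * exp (- \<bar>y - m\<bar>)))" using g by simp
  show "(\<lambda>y. g y * indicator {p..q} y) \<in> borel_measurable lborel"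
    using borel_measurable_if_integrable_laplace[OF g] by simp
  have "indicator {p..q} y \<le> C * exp (- \<bar>y - m\<bar>)" for y
    by (auto simp: C_def indicator_def simp flip: exp_add)
  then have "\<bar>g y\<bar> * indicator {p..q} y \<le> \<bar>g y\<bar> * (C * exp (- \<bar>y - m\<bar>))" for y
    by (intro mult_left_mono) auto
  then show "AE y in lborel. norm (g y * indicator {p..q} y) \<le> norm (C * (g y * exp (- \<bar>y - m\<bar>)))"
    by (auto simp: abs_mult C_def mult_ac)
qed

text \<open>
  By the layer cake formula \<open>exp (- \<bar>y\<bar>)\<close> is the average over \<open>u \<in> {0..1}\<close> of the indicators of its
  superlevel sets, which are the intervals \<open>{- ln (1 / u)..ln (1 / u)}\<close>. A Riemann sum over
  \<open>u = k / n\<close> rounds \<open>exp (- \<bar>y\<bar>)\<close> down to a multiple of \<open>1 / n\<close>; thus these sums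
  are dominated by the limit, and dominated convergence applies.
\<close>

lemma laplace_integral_zero_if_symmetric_intervals:
  fixes g :: "real \<Rightarrow> real"
  assumes g: "integrable lborel (\<lambda>y. g y * exp (- \<bar>y\<bar>))"
    and zero: "\<And>r. 0 \<le> r \<Longrightarrow> (LINT y|lborel. g y * indicator {-r..r} y) = 0"
  shows "(LINT y|lborel. g y * exp (- \<bar>y\<bar>)) = 0"
proof -
  define R :: "nat \<Rightarrow> nat \<Rightarrow> real" where "R n k = ln (real n / real k)" for n k
  define L :: "nat \<Rightarrow> real \<Rightarrow> real"
    where "L n y = (\<Sum>k\<in>{1..n}. indicator {- R n k..R n k} y) / real n" for n y
  have L_floor: "L n y = real_of_int \<lfloor>real n * exp (- \<bar>y\<bar>)\<rfloor> / real n" if n: "n > 0" for n y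
  proof -
    define z where "z = real n * exp (- \<bar>y\<bar>)"
    have z: "0 \<le> z" "z \<le> real n" by (auto simp: z_def mult_left_le)
    have mem: "y \<in> {- R n k..R n k} \<longleftrightarrow> real k \<le> z" if "k \<in> {1..n}" for k
    proof -
      have "y \<in> {- R n k..R n k} \<longleftrightarrow> \<bar>y\<bar> \<le> ln (real n / real k)" by (auto simp: R_def)
      also have "\<dots> \<longleftrightarrow> exp \<bar>y\<bar> \<le> real n / real k" using that n by (intro ln_ge_iff) auto
      also have "\<dots> \<longleftrightarrow> real k \<le> z"
        using that by (auto simp: z_def exp_minus field_simps)
      finally show ?thesis .
    qed
    have "(\<Sum>k\<in>{1..n}. indicator {- R n k..R n k} y :: real) = (\<Sum>k\<in>{1..n}. if real k \<le> z then 1 else 0)"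
      using mem by (intro sum.cong) (auto simp: indicator_def)
    also have "\<dots> = real (card {k \<in> {1..n}. real k \<le> z})"
      by (simp add: sum.If_cases Int_def)
    also have "{k \<in> {1..n}. real k \<le> z} = {1..nat \<lfloor>z\<rfloor>}"
      using z by (auto simp: le_nat_iff le_floor_iff)
    finally show ?thesis using z by (simp add: L_def z_def)
  qed
  have L_bounds: "0 \<le> L (Suc n) y" "L (Suc n) y \<le> exp (- \<bar>y\<bar>)"
      "exp (- \<bar>y\<bar>) - 1 / real (Suc n) \<le> L (Suc n) y" for n y
  proof -
    define z where "z = real (Suc n) * exp (- \<bar>y\<bar>)"
    have "exp (- \<bar>y\<bar>) = z / real (Suc n)" by (simp add: z_def)
    moreover have "L (Suc n) y = \<lfloor>z\<rfloor> / real (Suc n)" unfolding z_def by (rule L_floor) simp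
    moreover have "z \<ge> 0" "z - 1 \<le> \<lfloor>z\<rfloor>" "\<lfloor>z\<rfloor> \<le> z" by (auto simp: z_def)
    ultimately show "0 \<le> L (Suc n) y" "L (Suc n) y \<le> exp (- \<bar>y\<bar>)"
      "exp (- \<bar>y\<bar>) - 1 / real (Suc n) \<le> L (Suc n) y"
      by (simp_all add: divide_right_mono flip: diff_divide_distrib)
  qed
  have L_lim: "(\<lambda>n. L (Suc n) y) \<longlonglongrightarrow> exp (- \<bar>y\<bar>)" for y
  proof (rule tendsto_sandwich)
    show "(\<lambda>n. exp (- \<bar>y\<bar>) - 1 / real (Suc n)) \<longlonglongrightarrow> exp (- \<bar>y\<bar>)"
      using tendsto_diff[OF tendsto_const LIMSEQ_inverse_real_of_nat] by (simp add: inverse_eq_divide)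
  qed (use L_bounds in auto)
  have meas[measurable]: "g \<in> borel_measurable borel"
    using borel_measurable_if_integrable_laplace[of g 0] g by simp
  have [measurable]: "L n \<in> borel_measurable borel" for n
    unfolding L_def by measurable
  have int: "integrable lborel (\<lambda>y. g y * indicator {p..q} y)" for p q
    using integrable_on_interval_if_integrable_laplace[of g 0] g by simp
  have "(LINT y|lborel. g y * L n y) = 0" for n
  proof -
    have "(LINT y|lborel. g y * L n y)
        = (LINT y|lborel. (\<Sum>k\<in>{1..n}. g y * indicator {- R n k..R n k} y) / real n)"
      by (simp add: L_def sum_distrib_left)
    also have "\<dots> = (\<Sum>k\<in>{1..n}. LINT y|lborel. g y * indicator {- R n k..R n k} y) / real n"
      using int by (subst Bochner_Integration.integral_sum[symmetric]) (auto simp del: sum_indicator_eq_card)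
    also have "(\<Sum>k\<in>{1..n}. LINT y|lborel. g y * indicator {- R n k..R n k} y) = 0"
      by (intro sum.neutral ballI zero) (auto simp: R_def)
    finally show ?thesis by simp
  qed
  moreover have "(\<lambda>n. LINT y|lborel. g y * L (Suc n) y) \<longlonglongrightarrow> (LINT y|lborel. g y * exp (- \<bar>y\<bar>))"
  proof (rule integral_dominated_convergence)
    show "integrable lborel (\<lambda>y. \<bar>g y * exp (- \<bar>y\<bar>)\<bar>)" using g by (rule integrable_abs)
    show "AE y in lborel. (\<lambda>n. g y * L (Suc n) y) \<longlonglongrightarrow> g y * exp (- \<bar>y\<bar>)"
      using L_lim by (auto intro!: tendsto_mult)
    show "AE y in lborel. norm (g y * L (Suc n) y) \<le> \<bar>g y * exp (- \<bar>y\<bar>)\<bar>" for n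
      using L_bounds by (auto simp: abs_mult intro!: mult_left_mono)
  qed auto
  ultimately show ?thesis by (simp add: LIMSEQ_const_iff)
qed

section \<open>Unimodal approximation of uniform densities\<close>

text \<open>
  Up to the factor \<open>exp (- c * d)\<close>, with \<open>d\<close> the distance from \<open>y\<close> to \<open>{p..q}\<close>, this is a
  wide Laplace kernel. As \<open>c\<close> grows, the first factor cuts off everything outside
  \<open>{p..q}\<close>, and the second one becomes flat but keeps its strict peak at \<open>m\<close>.
\<close>

definition plateau :: "real \<Rightarrow> real \<Rightarrow> real \<Rightarrow> real \<Rightarrow> real \<Rightarrow> real" where
  "plateau p q m c y = exp (- (c * max 0 (max (p - y) (y - q)) + \<bar>y - m\<bar> / c))"

lemma strictly_unimodal_plateau:
  assumes "c > 0" "m \<in> {p..q}"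
  shows "strictly_unimodal m (plateau p q m c)"
proof -
  have "c * max 0 (max (p - y) (y - q)) \<le> c * max 0 (max (p - x) (x - q))
      \<and> \<bar>y - m\<bar> / c < \<bar>x - m\<bar> / c" if "x < y \<and> y \<le> m \<or> m \<le> y \<and> y < x" for x y
    using that assms by (intro conjI mult_left_mono divide_strict_right_mono) auto
  then show ?thesis
    unfolding strictly_unimodal_def plateau_def exp_less_cancel_iff neg_less_iff_less
    by (meson add_le_less_mono)
qed

text \<open>
  Since \<open>m\<close> lies in \<open>{p..q}\<close>, the distance of \<open>y\<close> to the interval falls short of \<open>\<bar>y - m\<bar>\<close> by at
  most \<open>q - p\<close>. The bound is uniform in \<open>c\<close>, which is what dominated convergence needs.
\<close>

lemma plateau_le_laplace:
  assumes "c \<ge> 1" "m \<in> {p..q}"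
  shows "plateau p q m c y \<le> exp (q - p) * exp (- \<bar>y - m\<bar>)"
proof -
  define d where "d = max 0 (max (p - y) (y - q))"
  have "\<bar>y - m\<bar> - (q - p) \<le> d" using assms(2) by (auto simp: d_def)
  also have "d \<le> c * d" using assms(1) by (simp add: d_def mult_le_cancel_right1)
  also have "\<dots> \<le> c * d + \<bar>y - m\<bar> / c" using assms(1) by simp
  finally show ?thesis by (simp add: plateau_def d_def flip: exp_add)
qed

lemma plateau_tendsto_indicator:
  "(\<lambda>n. plateau p q m (real (Suc n)) y) \<longlonglongrightarrow> indicator {p..q} y"
proof (cases "y \<in> {p..q}")
  case True
  have "(\<lambda>n. exp (- (\<bar>y - m\<bar> * inverse (real (Suc n))))) \<longlonglongrightarrow> exp (- (\<bar>y - m\<bar> * 0))"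
    by (intro tendsto_intros LIMSEQ_inverse_real_of_nat)
  moreover have "max 0 (max (p - y) (y - q)) = 0" using True by auto
  ultimately show ?thesis using True by (simp add: plateau_def divide_inverse)
next
  case False
  define d where "d = max 0 (max (p - y) (y - q))"
  have d: "d > 0" using False by (auto simp: d_def)
  have "(\<lambda>n. exp (- d) ^ Suc n) \<longlonglongrightarrow> 0"
    using d by (intro LIMSEQ_Suc LIMSEQ_power_zero) auto
  moreover have "plateau p q m (real (Suc n)) y \<le> exp (- d) ^ Suc n" for n
  proof -
    have "exp (- d) ^ Suc n = exp (- (real (Suc n) * d))"
      unfolding exp_of_nat_mult[symmetric] by simp
    then show ?thesis by (simp add: plateau_def flip: d_def)
  qed
  moreover have "0 \<le> plateau p q m (real (Suc n)) y" for n
    by (simp add: plateau_def)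
  ultimately have "(\<lambda>n. plateau p q m (real (Suc n)) y) \<longlonglongrightarrow> 0"
    using real_tendsto_sandwich[OF always_eventually always_eventually tendsto_const,
        of 0 "\<lambda>n. plateau p q m (real (Suc n)) y" "\<lambda>n. exp (- d) ^ Suc n" sequentially]
    by simp
  then show ?thesis using False by simp
qed

lemma continuous_on_plateau: "continuous_on UNIV (plateau p q m c)"
  unfolding plateau_def divide_inverse by (intro continuous_intros)

lemma integrable_plateau:
  assumes "c \<ge> 1" "m \<in> {p..q}"
  shows "integrable lborel (plateau p q m c)"
proof (rule Bochner_Integration.integrable_bound)
  show "integrable lborel (\<lambda>y. exp (q - p) * exp (- \<bar>y - m\<bar>))"
    using integrable_laplace by simp
  show "plateau p q m c \<in> borel_measurable lborel"
    using borel_measurable_continuous_onI[OF continuous_on_plateau] by simp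
  show "AE y in lborel. norm (plateau p q m c y) \<le> norm (exp (q - p) * exp (- \<bar>y - m\<bar>))"
    using plateau_le_laplace[OF assms] by (auto simp: plateau_def)
qed

section \<open>Scores over intervals\<close>

context
  fixes s :: "real \<Rightarrow> real \<Rightarrow> real"
  assumes s: "strictly_consistent F0 mode s"
begin

lemma integrable_score_laplace: "integrable lborel (\<lambda>y. s x y * exp (- \<bar>y - m\<bar>))"
  by (rule consistent_unnormalized(1)[OF s _ integrable_laplace _ strictly_unimodal_laplace])
     (auto intro!: continuous_intros)

lemma integrable_score_interval: "integrable lborel (\<lambda>y. s x y * indicator {p..q} y)"
  using integrable_on_interval_if_integrable_laplace integrable_score_laplace .

lemma borel_measurable_score: "s x \<in> borel_measurable borel"
  using borel_measurable_if_integrable_laplace integrable_score_laplace .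

lemma plateau_score_tendsto:
  assumes m: "m \<in> {p..q}"
  shows "(\<lambda>n. LINT y|lborel. s x y * plateau p q m (real (Suc n)) y)
      \<longlonglongrightarrow> (LINT y|lborel. s x y * indicator {p..q} y)"
proof (rule integral_dominated_convergence)
  show "integrable lborel (\<lambda>y. exp (q - p) * \<bar>s x y * exp (- \<bar>y - m\<bar>)\<bar>)"
    using integrable_score_laplace by (intro integrable_mult_right integrable_abs)
  show "(\<lambda>y. s x y * indicator {p..q} y) \<in> borel_measurable lborel"
    using borel_measurable_score by simp
  show "(\<lambda>y. s x y * plateau p q m (real (Suc n)) y) \<in> borel_measurable lborel" for n
    using borel_measurable_score borel_measurable_continuous_onI[OF continuous_on_plateau]
    by simp
  show "AE y in lborel. (\<lambda>n. s x y * plateau p q m (real (Suc n)) y) \<longlonglongrightarrow> s x y * indicator {p..q} y"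
    using plateau_tendsto_indicator by (auto intro!: tendsto_mult)
  show "AE y in lborel. norm (s x y * plateau p q m (real (Suc n)) y)
      \<le> exp (q - p) * \<bar>s x y * exp (- \<bar>y - m\<bar>)\<bar>" for n
  proof (intro always_eventually allI)
    fix y
    have "\<bar>s x y\<bar> * plateau p q m (real (Suc n)) y \<le> \<bar>s x y\<bar> * (exp (q - p) * exp (- \<bar>y - m\<bar>))"
      using m by (intro mult_left_mono plateau_le_laplace) auto
    then show "norm (s x y * plateau p q m (real (Suc n)) y)
        \<le> exp (q - p) * \<bar>s x y * exp (- \<bar>y - m\<bar>)\<bar>"
      by (simp add: abs_mult plateau_def mult_ac)
  qed
qed

lemma interval_score_le:
  assumes m: "m \<in> {p..q}"
  shows "(LINT y|lborel. s m y * indicator {p..q} y) \<le> (LINT y|lborel. s x y * indicator {p..q} y)"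
proof (rule LIMSEQ_le[OF plateau_score_tendsto[OF m] plateau_score_tendsto[OF m]], intro exI allI impI)
  fix n :: nat
  show "(LINT y|lborel. s m y * plateau p q m (real (Suc n)) y)
      \<le> (LINT y|lborel. s x y * plateau p q m (real (Suc n)) y)"
    using m by (intro consistent_unnormalized(2)[OF s] continuous_on_plateau integrable_plateau
        strictly_unimodal_plateau) (auto simp: plateau_def)
qed

text \<open>
  Only the weak inequality of consistency passes to the limit, but it does so for every choice of the
  peak: each point of the interval scores at least as well as each other one.
\<close>

lemma interval_score_eq_inside:
  assumes "m \<in> {p..q}" "x \<in> {p..q}"
  shows "(LINT y|lborel. s m y * indicator {p..q} y) = (LINT y|lborel. s x y * indicator {p..q} y)"
  using interval_score_le assms by (intro antisym)

lemma interval_score_split: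
  assumes "p \<le> q" "q \<le> r"
  shows "(LINT y|lborel. s x y * indicator {p..r} y)
    = (LINT y|lborel. s x y * indicator {p..q} y) + (LINT y|lborel. s x y * indicator {q..r} y)"
proof -
  have "AE y in lborel. s x y * indicator {p..r} y
      = s x y * indicator {p..q} y + s x y * indicator {q..r} y"
    using AE_lborel_singleton[of q]
    by eventually_elim (use assms in \<open>auto simp: indicator_def\<close>)
  then have "(LINT y|lborel. s x y * indicator {p..r} y)
      = (LINT y|lborel. s x y * indicator {p..q} y + s x y * indicator {q..r} y)"
    using borel_measurable_score by (intro integral_cong_AE) auto
  then show ?thesis by (simp add: integrable_score_interval)
qed

text \<open>
  A report \<open>x > q\<close> is compared with \<open>q\<close> on \<open>{p..x}\<close> and on \<open>{q..x}\<close>, both of which contain both points;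
  the score over \<open>{p..q}\<close> is the difference of these two scores.
\<close>

lemma interval_score_eq:
  assumes pq: "p \<le> q" and x: "p \<le> x"
  shows "(LINT y|lborel. s p y * indicator {p..q} y) = (LINT y|lborel. s x y * indicator {p..q} y)"
proof (cases "x \<le> q")
  case True
  then show ?thesis using pq x by (intro interval_score_eq_inside) auto
next
  case False
  have "(LINT y|lborel. s q y * indicator {p..x} y) = (LINT y|lborel. s x y * indicator {p..x} y)"
    "(LINT y|lborel. s q y * indicator {q..x} y) = (LINT y|lborel. s x y * indicator {q..x} y)"
    "(LINT y|lborel. s p y * indicator {p..q} y) = (LINT y|lborel. s q y * indicator {p..q} y)"
    using pq False by (auto intro!: interval_score_eq_inside)
  with interval_score_split[of p q x q] interval_score_split[of p q x x] pq False
  show ?thesis by simp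
qed

lemma laplace_score_eq:
  "(LINT y|lborel. s 0 y * exp (- \<bar>y\<bar>)) = (LINT y|lborel. s 1 y * exp (- \<bar>y\<bar>))"
proof -
  have int: "integrable lborel (\<lambda>y. s x y * exp (- \<bar>y\<bar>))" for x
    using integrable_score_laplace[of x 0] by simp
  have "(LINT y|lborel. (s 0 y - s 1 y) * exp (- \<bar>y\<bar>)) = 0"
  proof (rule laplace_integral_zero_if_symmetric_intervals)
    show "integrable lborel (\<lambda>y. (s 0 y - s 1 y) * exp (- \<bar>y\<bar>))"
      using int by (simp add: left_diff_distrib)
    fix r :: real assume "0 \<le> r"
    then show "(LINT y|lborel. (s 0 y - s 1 y) * indicator {- r..r} y) = 0"
      using interval_score_eq[of "-r" r 0] interval_score_eq[of "-r" r 1]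
      by (simp add: left_diff_distrib integrable_score_interval)
  qed
  then show ?thesis using int by (simp add: left_diff_distrib)
qed

end

theorem theorem1:
  shows "\<not> elicitable F0 mode"
proof
  assume "elicitable F0 mode"
  then obtain s where s: "strictly_consistent F0 mode s"
    by (auto simp: elicitable_def)
  have "1 = (0 :: real)"
  proof (rule consistent_unnormalized(3)[OF s])
    show "integrable lborel (\<lambda>y::real. exp (- \<bar>y\<bar>))"
      using integrable_laplace[of 0] by simp
    show "strictly_unimodal 0 (\<lambda>y. exp (- \<bar>y\<bar>))"
      using strictly_unimodal_laplace[of 0] by simp
  qed (auto intro!: continuous_intros simp: laplace_score_eq[OF s])
  then show False by simp
qed

end
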